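(* Let $\tilde{x}_k$ be the $k$-th iterate of the sketch-and-project method applied to the doubly noisy linear system $\widetilde{A}x=\tilde{b}$. Let $x_{LS}=A^{\dagger}b$ be the least-squares solution of the noiseless linear system $Ax=b$. Set $P_k=B^{-1}\widetilde{A}^{\top}H_k\widetilde{A}$ and $G=\mathbb{E}[P_k]$, where $H_k=S_k\left(S_k^{\top}\widetilde{A}B^{-1}\widetilde{A}^{\top}S_k\right)^{\dagger}S_k^{\top}$. Then for any initial point $\tilde{x}_0\in\mathbb{R}^n$ and any positive integer $k$, $$\mathbb{E}\|\tilde{x}_k-x_{LS}\|_B^2\le(1-\lambda_r)^k\left\|(\tilde{x}_0-x_{LS})_{\mathcal{R}(G)}\right\|_B^2+\left\|(\tilde{x}_0-x_{LS})_{\mathcal{N}(G)}\right\|_B^2+\frac{r^{\top}\mathbb{E}[H_k]\,r}{\lambda_r},$$ where $\lambda_r$ is the smallest nonzero eigenvalue of the matrix $G$ and $r=\tilde{b}-\widetilde{A}x_{LS}$.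
   Context: $A,\widetilde{A}\in\mathbb{R}^{m\times n}$ and $b,\tilde{b}\in\mathbb{R}^m$ are fixed (deterministic); $\widetilde{A},\tilde{b}$ are noisy versions of $A,b$. Neither $Ax=b$ nor $\widetilde{A}x=\tilde{b}$ is assumed consistent. $M^{\dagger}$ is the Moore-Penrose inverse, $\mathcal{R}(\cdot)$ and $\mathcal{N}(\cdot)$ denote range and null space. $B\in\mathbb{R}^{n\times n}$ is a symmetric positive definite matrix, with inner product $\langle x,y\rangle_B=\langle Bx,y\rangle$ and norm $\|x\|_B=\sqrt{\langle x,x\rangle_B}$. Sketch-and-project method for $\widetilde{A}x=\tilde{b}$: random sketch matrices $S_k\in\mathbb{R}^{m\times q}$, $k=1,2,\dots$, are drawn independently and identically distributed, and starting from a deterministic $\tilde{x}_0$, $$\tilde{x}_k=\tilde{x}_{k-1}-B^{-1}\widetilde{A}^{\top}S_k\left(S_k^{\top}\widetilde{A}B^{-1}\widetilde{A}^{\top}S_k\right)^{\dagger}S_k^{\top}\left(\widetilde{A}\tilde{x}_{k-1}-\tilde{b}\right).$$ $\mathbb{E}$ denotes expectation over all sketch matrices; by identical distribution, $G$ and $\mathbb{E}[H_k]$ do not depend on $k$. It is assumed that $\mathbb{E}[H_k]$ exists and that $G\neq0$. The matrix $G$ is self-adjoint with respect to $\langle\cdot,\cdot\rangle_B$, so $\mathcal{R}(G)$ and $\mathcal{N}(G)$ are $B$-orthogonal complements; $(x)_{\mathcal{R}(G)}$ and $(x)_{\mathcal{N}(G)}$ denote the components of $x$ in the decomposition $\mathbb{R}^n=\mathcal{R}(G)\oplus\mathcal{N}(G)$,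 orthogonal with respect to the $B$-inner product. *)

theory Defs
  imports "HOL-Probability.Probability"
begin

definition sym_pos_def :: "real^'n^'n \<Rightarrow> bool" where
  "sym_pos_def B \<longleftrightarrow> transpose B = B \<and> (\<forall>x. x \<noteq> 0 \<longrightarrow> 0 < (B *v x) \<bullet> x)"

definition inner_B :: "real^'n^'n \<Rightarrow> real^'n \<Rightarrow> real^'n \<Rightarrow> real" where
  "inner_B B x y = (B *v x) \<bullet> y"

definition norm_B :: "real^'n^'n \<Rightarrow> real^'n \<Rightarrow> real" where
  "norm_B B x = sqrt (inner_B B x x)"

text \<open>The Moore-Penrose inverse, given by the four Penrose equations; every real matrix has
  exactly one solution of them, so the definite description is always proper.\<close>

definition is_pinv :: "real^'n^'m \<Rightarrow> real^'m^'n \<Rightarrow> bool" where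
  "is_pinv M X \<longleftrightarrow>
     M ** X ** M = M \<and> X ** M ** X = X \<and>
     transpose (M ** X) = M ** X \<and> transpose (X ** M) = X ** M"

definition pinv :: "real^'n^'m \<Rightarrow> real^'m^'n" where
  "pinv M = (THE X. is_pinv M X)"

definition mat_eigenvalue :: "real^'n^'n \<Rightarrow> real \<Rightarrow> bool" where
  "mat_eigenvalue G l \<longleftrightarrow> (\<exists>v. v \<noteq> 0 \<and> G *v v = l *\<^sub>R v)"

text \<open>Only real eigenvalues are considered: this is used for matrices that are self-adjoint
  with respect to a \<open>B\<close>-inner product, all of whose complex eigenvalues are real.
  If such a matrix is nonzero, the least element below exists.\<close>

definition smallest_nonzero_eigenvalue :: "real^'n^'n \<Rightarrow> real" where
  "smallest_nonzero_eigenvalue G = (LEAST l. l \<noteq> 0 \<and> mat_eigenvalue G l)"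

definition mat_range :: "real^'n^'m \<Rightarrow> (real^'m) set" where
  "mat_range M = range (\<lambda>x. M *v x)"

definition mat_null :: "real^'n^'m \<Rightarrow> (real^'n) set" where
  "mat_null M = {x. M *v x = 0}"

text \<open>The component in \<open>U\<close> of \<open>x\<close> with respect to a direct sum decomposition of the whole
  space into subspaces \<open>U\<close> and \<open>W\<close>. With \<open>U\<close> and \<open>W\<close> the range and the null space of a
  \<open>B\<close>-self-adjoint matrix, the decomposition is \<open>B\<close>-orthogonal.\<close>

definition component_in :: "'a::real_vector set \<Rightarrow> 'a set \<Rightarrow> 'a \<Rightarrow> 'a" where
  "component_in U W x = (THE u. u \<in> U \<and> (\<exists>w\<in>W. x = u + w))"

text \<open>\<open>C\<close> is the (noisy) system matrix, \<open>d\<close> its right-hand side, \<open>Z\<close> a sketch matrix.\<close>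

definition sketch_H :: "real^'n^'n \<Rightarrow> real^'n^'m \<Rightarrow> real^'q^'m \<Rightarrow> real^'m^'m" where
  "sketch_H B C Z =
     Z ** pinv (transpose Z ** C ** matrix_inv B ** transpose C ** Z) ** transpose Z"

definition sketch_P :: "real^'n^'n \<Rightarrow> real^'n^'m \<Rightarrow> real^'q^'m \<Rightarrow> real^'n^'n" where
  "sketch_P B C Z = matrix_inv B ** transpose C ** sketch_H B C Z ** C"

text \<open>Iterates along a fixed sequence \<open>Z\<close> of sketch matrices; step \<open>k \<ge> 1\<close> uses \<open>Z k\<close>,
  and \<open>Z 0\<close> is never used.\<close>

primrec sketch_iterate ::
  "real^'n^'n \<Rightarrow> real^'n^'m \<Rightarrow> real^'m \<Rightarrow> (nat \<Rightarrow> real^'q^'m) \<Rightarrow> real^'n \<Rightarrow> nat \<Rightarrow> real^'n"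
where
  "sketch_iterate B C d Z x0 0 = x0"
| "sketch_iterate B C d Z x0 (Suc k) =
     (let x = sketch_iterate B C d Z x0 k in
      x - (matrix_inv B ** transpose C ** sketch_H B C (Z (Suc k))) *v (C *v x - d))"

definition iid_seq :: "'w measure \<Rightarrow> (nat \<Rightarrow> 'w \<Rightarrow> 'a::topological_space) \<Rightarrow> bool" where
  "iid_seq M S \<longleftrightarrow>
     prob_space.indep_vars M (\<lambda>_. borel) S {1..} \<and>
     (\<forall>i\<ge>1. \<forall>j\<ge>1. distr M borel (S i) = distr M borel (S j))"

end

theory Submission
  imports Defs
begin

text \<open>Write \<open>e\<^sub>j\<close> for the error of the \<open>j\<close>-th iterate with respect to \<open>x_LS\<close> and \<open>r\<close> for the
  residual there. One step of the method is
  \<open>e\<^sub>j = (I - P\<^sub>j) e\<^sub>j\<^sub>-\<^sub>1 + B\<^sup>-\<^sup>1 C\<^sup>T H\<^sub>j r\<close>, where \<open>C\<close> is the noisy matrix. Because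
  \<open>H\<^sub>j (C B\<^sup>-\<^sup>1 C\<^sup>T) H\<^sub>j = H\<^sub>j\<close>, the matrix \<open>P\<^sub>j\<close> is the \<open>B\<close>-orthogonal projection onto a subspace that
  contains the second summand, so Pythagoras gives an exact energy balance (\<open>step_norm\<close>): the
  squared norm loses \<open>\<langle>P\<^sub>j e, e\<rangle>\<^sub>B = (C e) \<bullet> H\<^sub>j (C e)\<close> and gains \<open>r \<bullet> H\<^sub>j r\<close>.

  Since \<open>S\<^sub>j\<close> is independent of \<open>e\<^sub>j\<^sub>-\<^sub>1\<close>, the loss has expectation
  \<open>E \<langle>G e\<^sub>j\<^sub>-\<^sub>1, e\<^sub>j\<^sub>-\<^sub>1\<rangle>\<^sub>B\<close> (\<open>expected_step\<close>). The smallest nonzero eigenvalue \<open>lam\<close> of the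
  self-adjoint, positive semidefinite \<open>G\<close> is the minimum of its Rayleigh quotient on the range
  (\<open>smallest_nonzero_eigenvalue_rayleigh\<close>). As long as the error stays in the range, the expected
  squared norm \<open>a\<^sub>j\<close> therefore satisfies \<open>a\<^sub>j \<le> (1 - lam) a\<^sub>j\<^sub>-\<^sub>1 + r \<bullet> E[H] r\<close>; here
  \<open>r \<bullet> E[H] r / lam\<close> is the fixed point of the affine bound, and \<open>lam \<le> 1\<close> because \<open>G\<close> is an
  average of projections.

  The null space of \<open>G\<close> is handled almost surely: for \<open>v\<close> in it, \<open>(C v) \<bullet> H\<^sub>j (C v)\<close> is nonnegative
  with expectation \<open>\<langle>G v, v\<rangle>\<^sub>B = 0\<close>, hence vanishes, and then so does \<open>H\<^sub>j C v\<close>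
  (\<open>AE_H_vanishes_on_null\<close>). So almost surely the component in the null space is carried along
  unchanged, and the component in the range evolves like the error of the same method started
  without the null component.

  Using independence requires \<open>H\<^sub>j\<close> to be a Borel function of \<open>S\<^sub>j\<close>, that is, Borel
  measurability of the pseudoinverse. The pseudoinverse is not continuous, but the Penrose equations
  are closed conditions, so its graph is closed, and a function with closed graph between Euclidean
  spaces is Borel (\<open>borel_measurable_closed_graph\<close>).\<close>

text \<open>Products with a transpose stay of the form \<open>transpose A *v x\<close>, so that the laws for \<open>(*v)\<close>
  apply to them.\<close>

declare transpose_matrix_vector [simp del]

section \<open>Real matrices\<close>

lemma inner_matrix_transpose: "(A *v x) \<bullet> y = x \<bullet> (transpose A *v y)"
  for A :: "real^'n^'m"
  by (metis dot_lmul_matrix inner_commute transpose_matrix_vector)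

lemma matrix_add_rdistrib: "(A + B) ** C = A ** C + B ** (C :: real^'p^'n)"
  by (simp add: matrix_matrix_mult_def vec_eq_iff distrib_right sum.distrib)

lemma bounded_bilinear_matrix_mult:
  "bounded_bilinear ((**) :: real^'n^'m \<Rightarrow> real^'p^'n \<Rightarrow> real^'p^'m)"
  unfolding bilinear_conv_bounded_bilinear[symmetric] bilinear_def
  by (auto intro!: linearI simp: matrix_add_ldistrib matrix_add_rdistrib
      scalar_matrix_assoc matrix_scalar_ac)

lemma bounded_bilinear_matrix_vector_mult:
  "bounded_bilinear ((*v) :: real^'n^'m \<Rightarrow> real^'n \<Rightarrow> real^'m)"
  unfolding bilinear_conv_bounded_bilinear[symmetric] bilinear_def
  by (auto intro!: linearI simp: algebra_simps scaleR_matrix_vector_assoc)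

lemmas continuous_on_matrix_mult [continuous_intros] =
  bounded_bilinear.continuous_on[OF bounded_bilinear_matrix_mult]

lemma bounded_linear_transpose: "bounded_linear (transpose :: real^'n^'m \<Rightarrow> real^'m^'n)"
  by (auto simp: linear_conv_bounded_linear[symmetric] transpose_def vec_eq_iff intro!: linearI)

lemmas continuous_on_transpose [continuous_intros] =
  bounded_linear.continuous_on[OF bounded_linear_transpose]

lemma borel_measurable_matrix_mult [measurable (raw)]:
  fixes f :: "'a \<Rightarrow> real^'n^'m" and g :: "'a \<Rightarrow> real^'p^'n"
  assumes "f \<in> borel_measurable M" "g \<in> borel_measurable M"
  shows "(\<lambda>x. f x ** g x) \<in> borel_measurable M"
  using assms by (rule borel_measurable_continuous_Pair) (intro continuous_intros)

lemma borel_measurable_matrix_vector_mult [measurable (raw)]: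
  fixes f :: "'a \<Rightarrow> real^'n^'m" and g :: "'a \<Rightarrow> real^'n"
  assumes "f \<in> borel_measurable M" "g \<in> borel_measurable M"
  shows "(\<lambda>x. f x *v g x) \<in> borel_measurable M"
  using assms
  by (rule borel_measurable_continuous_Pair)
     (intro continuous_intros bounded_bilinear.continuous_on[OF bounded_bilinear_matrix_vector_mult])

lemma borel_measurable_transpose [measurable]:
  "(transpose :: real^'n^'m \<Rightarrow> real^'m^'n) \<in> borel_measurable borel"
  by (intro borel_measurable_continuous_onI continuous_intros)

lemma symmetric_matrixI:
  fixes Q :: "real^'n^'n"
  assumes "\<And>x y. (Q *v x) \<bullet> y = x \<bullet> (Q *v y)"
  shows "transpose Q = Q"
proof -
  have "transpose Q *v y = Q *v y" for y
    by (subst vector_eq_ldot[symmetric]) (simp add: assms flip: inner_matrix_transpose)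
  then show ?thesis by (simp add: matrix_eq)
qed

lemma matrix_inv_right_left:
  fixes K :: "real^'n^'n"
  assumes "\<And>x. K *v x = 0 \<Longrightarrow> x = 0"
  shows "K ** matrix_inv K = mat 1" "matrix_inv K ** K = mat 1"
proof -
  have "invertible K"
    using assms by (auto simp: invertible_left_inverse matrix_left_invertible_ker)
  then have "K ** matrix_inv K = mat 1 \<and> matrix_inv K ** K = mat 1"
    unfolding invertible_def matrix_inv_def by (rule someI_ex)
  then show "K ** matrix_inv K = mat 1" "matrix_inv K ** K = mat 1" by auto
qed

lemma orthogonal_projection_matrix_exists:
  fixes N :: "(real^'n) set"
  assumes "subspace N"
  obtains Q :: "real^'n^'n"
  where "transpose Q = Q" "\<And>x. Q *v x \<in> N" "\<And>x. x \<in> N \<Longrightarrow> Q *v x = x"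
proof -
  obtain D where D: "D \<subseteq> N" "pairwise orthogonal D" "\<And>x. x \<in> D \<Longrightarrow> norm x = 1"
      "independent D" "span D = N"
    using orthonormal_basis_subspace[OF assms] by metis
  have fin: "finite D" using D(4) by (rule independent_imp_finite)
  define q where "q x = (\<Sum>d\<in>D. (d \<bullet> x) *\<^sub>R d)" for x
  have "linear q"
    unfolding q_def
    by (rule linearI)
       (simp_all add: inner_add_right scaleR_add_left sum.distrib scaleR_sum_right)
  then have Q: "matrix q *v x = q x" for x by (simp add: matrix_works)
  have sym: "(q x) \<bullet> y = x \<bullet> (q y)" for x y
    unfolding q_def by (simp add: inner_sum_left inner_sum_right inner_commute mult.commute)
  have mem: "q x \<in> N" for x
    unfolding q_def D(5)[symmetric] by (intro span_sum span_scale span_base)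
  have fixed: "q d = d" if "d \<in> D" for d
  proof -
    have "q d = (\<Sum>c\<in>D. if c = d then d else 0)"
      unfolding q_def
      by (rule sum.cong)
        (use that D(2,3) in \<open>auto simp: pairwise_def orthogonal_def dot_square_norm\<close>)
    also have "\<dots> = d" using fin that by simp
    finally show ?thesis .
  qed
  have "q x = x" if "x \<in> N" for x
    using that unfolding D(5)[symmetric]
    by (rule real_vector.linear_eq_on_span[OF \<open>linear q\<close> linear_id, of D x, simplified, rotated])
       (simp add: fixed)
  then show thesis
    using sym mem by (intro that[of "matrix q"]) (auto intro: symmetric_matrixI simp: Q)
qed

section \<open>The Moore-Penrose inverse\<close>

text \<open>\<open>M X\<close> and \<open>M Y\<close> are symmetric and each fixes the other from the left, so they are equal;
  likewise \<open>X M = Y M\<close>. Then \<open>X = X M X = Y M Y = Y\<close>.\<close>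

lemma is_pinv_unique:
  assumes "is_pinv M X" "is_pinv M Y"
  shows "X = Y"
proof -
  have "M ** X = M ** Y"
  proof -
    have "M ** X = transpose (M ** X)" using assms by (simp add: is_pinv_def)
    also have "\<dots> = transpose ((M ** Y) ** (M ** X))"
      using assms by (simp add: is_pinv_def matrix_mul_assoc)
    also have "\<dots> = (M ** X) ** (M ** Y)"
      using assms by (simp add: is_pinv_def matrix_transpose_mul)
    also have "\<dots> = M ** Y" using assms by (simp add: is_pinv_def matrix_mul_assoc)
    finally show ?thesis .
  qed
  moreover have "X ** M = Y ** M"
  proof -
    have "X ** M = transpose (X ** M)" using assms by (simp add: is_pinv_def)
    also have "\<dots> = transpose ((X ** M) ** (Y ** M))"
      using assms by (metis is_pinv_def matrix_mul_assoc)
    also have "\<dots> = (Y ** M) ** (X ** M)"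
      using assms by (simp add: is_pinv_def matrix_transpose_mul)
    also have "\<dots> = Y ** M" using assms by (metis is_pinv_def matrix_mul_assoc)
    finally show ?thesis .
  qed
  ultimately show ?thesis using assms by (metis is_pinv_def matrix_mul_assoc)
qed

text \<open>With \<open>Q\<close> the orthogonal projection onto the null space, \<open>K + Q\<close> is invertible: it acts as \<open>K\<close>
  on the range of \<open>K\<close> and as the identity on the null space, and these are complementary. Its inverse
  agrees with the pseudoinverse on the range but is the identity on the null space, so the
  pseudoinverse is \<open>(K + Q)\<^sup>-\<^sup>1 - Q\<close>.\<close>
lemma is_pinv_exists_symmetric:
  fixes K :: "real^'n^'n"
  assumes "transpose K = K"
  shows "\<exists>X. is_pinv K X"
proof -
  have "subspace (mat_null K)"
    by (auto simp: subspace_def mat_null_def algebra_simps)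
  then obtain Q :: "real^'n^'n" where Q: "transpose Q = Q" "\<And>x. Q *v x \<in> mat_null K"
      "\<And>x. x \<in> mat_null K \<Longrightarrow> Q *v x = x"
    using orthogonal_projection_matrix_exists by blast
  have KQ: "K ** Q = 0" and QQ: "Q ** Q = Q"
    using Q by (auto simp: matrix_eq mat_null_def simp flip: matrix_vector_mul_assoc)
  have QK: "Q ** K = 0"
    using arg_cong[OF KQ, of transpose] assms Q(1)
    by (simp add: matrix_transpose_mul) (simp add: transpose_def zero_vec_def)
  define L where "L = matrix_inv (K + Q)"
  have "x = 0" if "(K + Q) *v x = 0" for x
  proof -
    have "K *v x + Q *v x = 0" using that by (simp add: algebra_simps)
    moreover have "Q *v (K *v x + Q *v x) = Q *v x"
      by (simp add: matrix_vector_right_distrib matrix_vector_mul_assoc QK QQ)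
    ultimately have "Q *v x = 0" "K *v x = 0" by auto
    then show ?thesis using Q(3)[of x] by (simp add: mat_null_def)
  qed
  then have L: "(K + Q) ** L = mat 1" "L ** (K + Q) = mat 1"
    unfolding L_def by (rule matrix_inv_right_left; blast)+
  have QL: "Q ** L = Q"
  proof -
    have "Q ** L = (Q ** (K + Q)) ** L" by (simp add: matrix_add_ldistrib QK QQ)
    then show ?thesis by (simp add: L flip: matrix_mul_assoc)
  qed
  have LQ: "L ** Q = Q"
  proof -
    have "L ** Q = L ** ((K + Q) ** Q)" by (simp add: matrix_add_rdistrib KQ QQ)
    then show ?thesis by (simp add: L matrix_mul_assoc)
  qed
  have KL: "K ** L = mat 1 - Q"
    using L(1) by (simp add: matrix_add_rdistrib QL eq_diff_eq)
  have LK: "L ** K = mat 1 - Q"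
    using L(2) by (simp add: matrix_add_ldistrib LQ eq_diff_eq)
  note diff = bounded_bilinear.diff_left[OF bounded_bilinear_matrix_mult]
    bounded_bilinear.diff_right[OF bounded_bilinear_matrix_mult]
  have KX: "K ** (L - Q) = mat 1 - Q" and XK: "(L - Q) ** K = mat 1 - Q"
    by (simp_all add: diff KL LK KQ QK)
  have "transpose (mat 1 - Q) = mat 1 - Q"
    using Q(1) by (simp add: bounded_linear.linear[OF bounded_linear_transpose] linear_diff)
  then have "is_pinv K (L - Q)"
    unfolding is_pinv_def KX XK by (simp add: diff QK QL QQ)
  then show ?thesis ..
qed

lemma is_pinv_transpose:
  assumes "is_pinv M X"
  shows "is_pinv (transpose M) (transpose X)"
proof -
  have eqs: "M ** X ** M = M" "X ** M ** X = X"
      "transpose (M ** X) = M ** X" "transpose (X ** M) = X ** M"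
    using assms by (auto simp: is_pinv_def)
  have "transpose M ** transpose X ** transpose M = transpose M"
      "transpose X ** transpose M ** transpose X = transpose X"
    using arg_cong[OF eqs(1), of transpose] arg_cong[OF eqs(2), of transpose]
    by (simp_all add: matrix_transpose_mul matrix_mul_assoc)
  then show ?thesis
    using eqs(3,4) unfolding is_pinv_def by (simp add: matrix_transpose_mul)
qed

text \<open>\<open>M\<^sup>T M d = 0\<close> forces \<open>(M d) \<bullet> (M d) = 0\<close>.\<close>

lemma gram_matrix_cancel:
  fixes M :: "real^'n^'m" and U V :: "real^'p^'n"
  assumes "transpose M ** M ** U = transpose M ** M ** V"
  shows "M ** U = M ** V"
proof -
  have "M *v (U *v x) = M *v (V *v x)" for x
  proof -
    define d where "d = U *v x - V *v x"
    have "transpose M *v (M *v d) = 0"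
      using arg_cong[OF assms, of "\<lambda>Z. Z *v x"]
      unfolding d_def by (simp add: matrix_vector_mult_diff_distrib flip: matrix_vector_mul_assoc)
    then have "(M *v d) \<bullet> (M *v d) = 0" by (simp add: inner_matrix_transpose)
    then show ?thesis unfolding d_def by (simp add: matrix_vector_mult_diff_distrib)
  qed
  then show ?thesis by (simp add: matrix_eq flip: matrix_vector_mul_assoc)
qed

text \<open>The definite description in \<open>pinv\<close> is proper. Existence reduces to the symmetric Gram matrix:
  if \<open>Y\<close> is the pseudoinverse of \<open>M\<^sup>T M\<close>, then \<open>Y M\<^sup>T\<close> is that of \<open>M\<close>.\<close>
lemma is_pinv_pinv: "is_pinv M (pinv M)"
proof -
  let ?T = "transpose M"
  have sym: "transpose (?T ** M) = ?T ** M" by (simp add: matrix_transpose_mul)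
  then obtain Y where Y: "is_pinv (?T ** M) Y" using is_pinv_exists_symmetric by blast
  have Yt: "transpose Y = Y"
    using is_pinv_unique[OF _ Y] is_pinv_transpose[OF Y] unfolding sym by blast
  have eqs: "?T ** M ** Y ** (?T ** M) = ?T ** M" "Y ** (?T ** M) ** Y = Y"
      "transpose (Y ** (?T ** M)) = Y ** (?T ** M)"
    using Y by (auto simp: is_pinv_def)
  have "M ** (Y ** ?T ** M) = M ** mat 1"
    by (rule gram_matrix_cancel) (use eqs(1) in \<open>simp add: matrix_mul_assoc\<close>)
  then have "is_pinv M (Y ** ?T)"
    using eqs(2,3) unfolding is_pinv_def
    by (simp add: matrix_mul_assoc) (simp add: matrix_transpose_mul Yt matrix_mul_assoc)
  then show ?thesis
    unfolding pinv_def by (rule theI[where P="is_pinv M"]) (blast intro: is_pinv_unique \<open>is_pinv M (Y ** ?T)\<close>)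
qed

lemma pinv_eqI: "is_pinv M X \<Longrightarrow> pinv M = X"
  by (rule is_pinv_unique[OF is_pinv_pinv])

lemma transpose_pinv_symmetric: "transpose K = K \<Longrightarrow> transpose (pinv K) = pinv K"
  using pinv_eqI[OF is_pinv_transpose[OF is_pinv_pinv[of K]]] by simp

section \<open>Borel measurability of the pseudoinverse\<close>

text \<open>Over a compact set of values the projection of the closed graph to the domain is closed. A closed
  set of values is a countable union of compact ones, so its preimage is a countable union of closed
  sets.\<close>
lemma borel_measurable_closed_graph:
  fixes g :: "'a::euclidean_space \<Rightarrow> 'b::euclidean_space"
  assumes "closed {(x, y). y = g x}"
  shows "g \<in> borel_measurable borel"
proof (rule borel_measurableI)
  fix U :: "'b set" assume "open U"
  define F where "F = - U"
  have "closed F" using \<open>open U\<close> unfolding F_def by (rule closed_Compl)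
  have *: "closed {x. g x \<in> F \<inter> cball 0 (real n)}" for n :: nat
  proof -
    have "compact (F \<inter> cball 0 (real n))"
      using \<open>closed F\<close> by (intro closed_Int_compact) auto
    moreover have "closed ((\<lambda>p. (snd p, fst p)) -` {(x, y). y = g x})"
      by (rule closed_vimage[OF assms]) (intro continuous_intros)
    ultimately have "closed {x. \<exists>y. y \<in> F \<inter> cball 0 (real n) \<and>
        (y, x) \<in> (\<lambda>p. (snd p, fst p)) -` {(x, y). y = g x}}"
      by (rule closed_compact_projection)
    also have "{x. \<exists>y. y \<in> F \<inter> cball 0 (real n) \<and>
        (y, x) \<in> (\<lambda>p. (snd p, fst p)) -` {(x, y). y = g x}}
        = {x. g x \<in> F \<inter> cball 0 (real n)}"
      by auto
    finally show ?thesis .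
  qed
  have "g -` F = (\<Union>n. {x. g x \<in> F \<inter> cball 0 (real n)})"
    using real_arch_simple by auto
  also have "\<dots> \<in> sets borel" using * by (intro sets.countable_UN) auto
  finally have "- (g -` F) \<in> sets borel" by (simp add: borel_comp)
  then show "g -` U \<inter> space borel \<in> sets borel" by (simp add: F_def vimage_Compl)
qed

lemma borel_measurable_pinv [measurable]:
  "(pinv :: real^'n^'m \<Rightarrow> real^'m^'n) \<in> borel_measurable borel"
proof (rule borel_measurable_closed_graph)
  have "{(M, X). X = pinv M} = {(M :: real^'n^'m, X). is_pinv M X}"
    using is_pinv_pinv pinv_eqI by auto
  also have "closed \<dots>"
    unfolding is_pinv_def case_prod_beta
    by (intro closed_Collect_conj closed_Collect_eq continuous_on_matrix_mult
        continuous_on_transpose continuous_on_fst continuous_on_snd continuous_on_id)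
  finally show "closed {(M :: real^'n^'m, X). X = pinv M}" .
qed

section \<open>Self-adjoint matrices in the weighted inner product\<close>

locale weighted_inner =
  fixes B :: "real^'n^'n"
  assumes spd: "sym_pos_def B"
begin

sublocale ip: bounded_bilinear "inner_B B"
  unfolding inner_B_def
  by (rule bounded_bilinear.comp1[OF bounded_bilinear_inner matrix_vector_mul_bounded_linear])

lemma inner_B_commute: "inner_B B x y = inner_B B y x"
proof -
  have "inner_B B x y = x \<bullet> (B *v y)"
    using spd by (simp add: inner_B_def inner_matrix_transpose sym_pos_def_def)
  then show ?thesis by (simp add: inner_B_def inner_commute)
qed

lemma inner_B_pos: "x \<noteq> 0 \<Longrightarrow> 0 < inner_B B x x"
  using spd by (simp add: inner_B_def sym_pos_def_def)

lemma inner_B_nonneg: "0 \<le> inner_B B x x"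
  using inner_B_pos[of x] by (cases "x = 0") (auto simp: ip.zero_left)

lemma inner_B_eq_0_iff [simp]: "inner_B B x x = 0 \<longleftrightarrow> x = 0"
  using inner_B_pos[of x] by (cases "x = 0") (auto simp: ip.zero_left)

lemma norm_B_square: "(norm_B B x)\<^sup>2 = inner_B B x x"
  by (simp add: norm_B_def inner_B_nonneg)

lemma inner_B_square_add:
  "inner_B B (x + y) (x + y) = inner_B B x x + 2 * inner_B B x y + inner_B B y y"
  by (simp add: ip.add_left ip.add_right inner_B_commute[of y x])

lemma inner_B_square_diff:
  "inner_B B (x - y) (x - y) = inner_B B x x - 2 * inner_B B x y + inner_B B y y"
  by (simp add: ip.diff_left ip.diff_right inner_B_commute[of y x])

lemma matrix_inv_B: "B ** matrix_inv B = mat 1" "matrix_inv B ** B = mat 1"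
proof -
  have "x = 0" if "B *v x = 0" for x
    using that inner_B_pos[of x] by (auto simp: inner_B_def)
  then show "B ** matrix_inv B = mat 1" "matrix_inv B ** B = mat 1"
    by (rule matrix_inv_right_left; blast)+
qed

lemma B_mult_inv: "B *v (matrix_inv B *v x) = x"
  by (simp add: matrix_vector_mul_assoc matrix_inv_B)

lemma transpose_matrix_inv_B: "transpose (matrix_inv B) = matrix_inv B"
proof -
  let ?I = "matrix_inv B"
  have "transpose ?I ** B = mat 1"
    using arg_cong[OF matrix_inv_B(1), of transpose] spd
    by (simp add: matrix_transpose_mul sym_pos_def_def)
  then have "transpose ?I ** B ** ?I = ?I" by simp
  then show ?thesis by (simp add: matrix_inv_B flip: matrix_mul_assoc)
qed

text \<open>By compactness of the unit sphere. Square integrability in the \<open>B\<close>-norm thereby carries over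
  to linear images of the error.\<close>
lemma inner_B_coercive:
  obtains c where "c > 0" "\<And>x. c * (norm x)\<^sup>2 \<le> inner_B B x x"
proof -
  have "\<exists>u\<in>sphere 0 1. \<forall>v\<in>sphere 0 1. inner_B B u u \<le> inner_B B v v"
  proof (rule continuous_attains_inf)
    have "norm (axis undefined 1 :: real^'n) = 1" by simp
    then show "sphere (0 :: real^'n) 1 \<noteq> {}" by force
    show "continuous_on (sphere 0 1) (\<lambda>v. inner_B B v v)"
      by (intro ip.continuous_on continuous_on_id)
  qed simp
  then obtain u where u: "norm u = 1" "\<And>v. norm v = 1 \<Longrightarrow> inner_B B u u \<le> inner_B B v v"
    by auto
  have "inner_B B u u * (norm x)\<^sup>2 \<le> inner_B B x x" for x
  proof (cases "x = 0")
    case False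
    then have "inner_B B u u \<le> inner_B B ((1 / norm x) *\<^sub>R x) ((1 / norm x) *\<^sub>R x)"
      by (intro u) simp
    then show ?thesis
      using False by (simp add: ip.scaleR_left ip.scaleR_right power2_eq_square field_simps)
  qed (simp add: ip.zero_left)
  moreover have "inner_B B u u > 0" using u(1) by (intro inner_B_pos) auto
  ultimately show thesis by (rule that[rotated])
qed

end

locale self_adjoint_psd = weighted_inner B for B :: "real^'n^'n" +
  fixes G :: "real^'n^'n"
  assumes self_adjoint: "inner_B B (G *v x) y = inner_B B x (G *v y)"
    and psd: "0 \<le> inner_B B (G *v x) x"
begin

lemma subspace_mat_range: "subspace (mat_range G)"
  unfolding mat_range_def by (intro linear_subspace_image) auto

lemma subspace_mat_null: "subspace (mat_null G)"
  by (auto simp: subspace_def mat_null_def algebra_simps)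

lemma range_orthogonal_null:
  "u \<in> mat_range G \<Longrightarrow> w \<in> mat_null G \<Longrightarrow> inner_B B u w = 0"
  by (auto simp: mat_range_def mat_null_def self_adjoint ip.zero_right)

lemma range_inter_null: "u \<in> mat_range G \<Longrightarrow> u \<in> mat_null G \<Longrightarrow> u = 0"
  using range_orthogonal_null[of u u] by simp

text \<open>Range and null space meet only in \<open>0\<close>, so \<open>G\<close> maps its range injectively, hence by dimension
  bijectively, to itself. The range component of \<open>x\<close> is the preimage of \<open>G x\<close> under this bijection.\<close>
lemma range_null_decomposition:
  obtains u w where "u \<in> mat_range G" "w \<in> mat_null G" "x = u + w"
proof -
  let ?R = "mat_range G"
  have "inj_on ((*v) G) ?R"
    using subspace_mat_range range_inter_null
    by (subst linear_injective_on_subspace_0) (auto simp: mat_null_def)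
  then have "dim ((*v) G ` ?R) = dim ?R"
    using subspace_mat_range by (intro dim_image_eq) (auto simp: span_eq_iff[THEN iffD2])
  moreover have "(*v) G ` ?R \<subseteq> ?R" by (auto simp: mat_range_def)
  ultimately have "(*v) G ` ?R = ?R"
    using subspace_mat_range by (intro subspace_dim_equal linear_subspace_image) auto
  moreover have "G *v x \<in> ?R" by (auto simp: mat_range_def)
  ultimately obtain u where "u \<in> ?R" "G *v x = G *v u" by blast
  then show thesis
    by (intro that[of u "x - u"]) (auto simp: mat_null_def matrix_vector_mult_diff_distrib)
qed

lemma component_in_range_null:
  assumes "u \<in> mat_range G" "w \<in> mat_null G"
  shows "component_in (mat_range G) (mat_null G) (u + w) = u"
    and "component_in (mat_null G) (mat_range G) (u + w) = w"
proof -
  have unique: "u' = u \<and> w' = w"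
    if "u' \<in> mat_range G" "w' \<in> mat_null G" "u + w = u' + w'" for u' w'
  proof -
    have "u - u' = w' - w" using that(3) by (simp add: algebra_simps)
    moreover have "u - u' \<in> mat_range G" "w' - w \<in> mat_null G"
      using assms that subspace_mat_range subspace_mat_null by (auto intro: subspace_diff)
    ultimately have "u - u' = 0" by (intro range_inter_null) auto
    then show ?thesis using that(3) by auto
  qed
  show "component_in (mat_range G) (mat_null G) (u + w) = u"
    unfolding component_in_def using assms unique by (intro the_equality) blast+
  show "component_in (mat_null G) (mat_range G) (u + w) = w"
    unfolding component_in_def
  proof (rule the_equality)
    show "w \<in> mat_null G \<and> (\<exists>v\<in>mat_range G. u + w = w + v)"
      using assms by (auto intro!: bexI[of _ u] simp: add.commute)
    fix w' assume "w' \<in> mat_null G \<and> (\<exists>v\<in>mat_range G. u + w = w' + v)"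
    then obtain v where "v \<in> mat_range G" "w' \<in> mat_null G" "u + w = v + w'"
      by (auto simp: add.commute)
    then show "w' = w" using unique by blast
  qed
qed

lemma orthogonal_null_imp_range:
  assumes "\<And>w. w \<in> mat_null G \<Longrightarrow> inner_B B x w = 0"
  shows "x \<in> mat_range G"
proof -
  obtain u w where x: "u \<in> mat_range G" "w \<in> mat_null G" "x = u + w"
    by (rule range_null_decomposition)
  have "inner_B B w w = 0"
    using assms[OF x(2)] range_orthogonal_null[OF x(1,2)] by (simp add: x(3) ip.add_left)
  then show ?thesis using x by simp
qed

text \<open>On the compact unit sphere of the range the Rayleigh quotient has a minimum \<open>mu\<close>, attained at
  some \<open>u\<close>. A first variation of \<open>u\<close> along \<open>h = G u - mu u\<close> shows that \<open>h = 0\<close>, so \<open>mu\<close> is an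
  eigenvalue; it is nonzero because the null space meets the range only in \<open>0\<close>. Every eigenvector
  for a nonzero eigenvalue lies in the range, so no nonzero eigenvalue is smaller.\<close>
lemma smallest_nonzero_eigenvalue_rayleigh:
  assumes "G \<noteq> 0"
  defines "lam \<equiv> smallest_nonzero_eigenvalue G"
  shows "0 < lam" and "mat_eigenvalue G lam"
    and "\<And>x. x \<in> mat_range G \<Longrightarrow> lam * inner_B B x x \<le> inner_B B (G *v x) x"
proof -
  let ?R = "mat_range G"
  define rho where "rho x = inner_B B (G *v x) x / inner_B B x x" for x
  obtain y where y: "G *v y \<noteq> 0" using assms(1) by (auto simp: matrix_eq)
  have "\<exists>u\<in>?R \<inter> sphere 0 1. \<forall>v\<in>?R \<inter> sphere 0 1. rho u \<le> rho v"
  proof (rule continuous_attains_inf)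
    have "closed ?R" using subspace_mat_range by (rule closed_subspace)
    then show "compact (?R \<inter> sphere 0 1)" by (intro closed_Int_compact) auto
    have "(1 / norm (G *v y)) *\<^sub>R (G *v y) \<in> ?R \<inter> sphere 0 1"
      using y subspace_mat_range by (auto simp: mat_range_def intro!: subspace_scale)
    then show "?R \<inter> sphere 0 1 \<noteq> {}" by blast
    show "continuous_on (?R \<inter> sphere 0 1) rho"
      unfolding rho_def
      by (intro continuous_on_divide ip.continuous_on matrix_vector_mult_linear_continuous_on
          continuous_on_id) auto
  qed
  then obtain u where u: "u \<in> ?R" "norm u = 1"
    and min: "\<And>v. v \<in> ?R \<Longrightarrow> norm v = 1 \<Longrightarrow> rho u \<le> rho v" by auto
  define mu where "mu = rho u"
  have rayleigh: "mu * inner_B B x x \<le> inner_B B (G *v x) x" if "x \<in> ?R" for x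
  proof (cases "x = 0")
    case False
    let ?v = "(1 / norm x) *\<^sub>R x"
    have "rho u \<le> rho ?v"
      using False that subspace_mat_range by (intro min) (auto intro: subspace_scale)
    also have "rho ?v = rho x"
      using False by (simp add: rho_def ip.scaleR_left ip.scaleR_right matrix_vector_mult_scaleR)
    finally show ?thesis
      using inner_B_pos[OF False] by (simp add: mu_def rho_def field_simps)
  qed (simp add: ip.zero_left ip.zero_right)
  have "u \<noteq> 0" using u(2) by auto
  define h where "h = G *v u - mu *\<^sub>R u"
  have hR: "h \<in> ?R"
    unfolding h_def using u(1) subspace_mat_range
    by (intro subspace_diff subspace_scale) (auto simp: mat_range_def)
  have "h = 0"
  proof (rule ccontr)
    assume "h \<noteq> 0"
    define p where "p = inner_B B (G *v h) h - mu * inner_B B h h"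
    define q where "q = inner_B B h h"
    \<comment> \<open>At \<open>x = u + t h\<close> the form \<open>\<langle>G x, x\<rangle> - mu \<langle>x, x\<rangle>\<close> is \<open>2 t q + t\<^sup>2 p\<close>, negative for this \<open>t\<close>; the
      summand \<open>1\<close> avoids division by zero if \<open>p = 0\<close>.\<close>
    define t where "t = - q / (p + 1)"
    have "p \<ge> 0" using rayleigh[OF hR] by (simp add: p_def)
    have "q > 0" using inner_B_pos[OF \<open>h \<noteq> 0\<close>] by (simp add: q_def)
    have "inner_B B (G *v u) u - mu * inner_B B u u = 0"
      using \<open>u \<noteq> 0\<close> by (simp add: mu_def rho_def)
    moreover have "inner_B B (G *v h) u = inner_B B (G *v u) h"
      by (metis self_adjoint inner_B_commute)
    moreover have "inner_B B (G *v u) h = q + mu * inner_B B u h"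
      by (simp add: q_def h_def ip.diff_left ip.scaleR_left)
    ultimately have "inner_B B (G *v (u + t *\<^sub>R h)) (u + t *\<^sub>R h)
        - mu * inner_B B (u + t *\<^sub>R h) (u + t *\<^sub>R h) = 2 * t * q + t\<^sup>2 * p"
      by (simp add: p_def ip.add_left ip.add_right ip.scaleR_left ip.scaleR_right
          matrix_vector_right_distrib matrix_vector_mult_scaleR inner_B_commute[of h u]
          power2_eq_square algebra_simps)
    moreover have "u + t *\<^sub>R h \<in> ?R"
      using u(1) hR subspace_mat_range by (intro subspace_add subspace_scale)
    ultimately have "0 \<le> 2 * t * q + t\<^sup>2 * p" using rayleigh by force
    also have "\<dots> = q\<^sup>2 / (p + 1)\<^sup>2 * (- p - 2)"
      using \<open>p \<ge> 0\<close> unfolding t_def by (simp add: power2_eq_square divide_simps) algebra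
    also have "\<dots> < 0"
      using \<open>p \<ge> 0\<close> \<open>q > 0\<close> by (intro mult_pos_neg) auto
    finally show False by simp
  qed
  then have eigen: "G *v u = mu *\<^sub>R u" by (simp add: h_def)
  have "mu \<noteq> 0"
    using eigen range_inter_null[OF u(1)] \<open>u \<noteq> 0\<close> by (auto simp: mat_null_def)
  moreover have "mu \<ge> 0"
    unfolding mu_def rho_def using psd inner_B_nonneg by auto
  ultimately have "mu > 0" by simp
  have "lam = mu"
    unfolding lam_def smallest_nonzero_eigenvalue_def
  proof (rule Least_equality)
    show "mu \<noteq> 0 \<and> mat_eigenvalue G mu"
      using \<open>mu \<noteq> 0\<close> eigen \<open>u \<noteq> 0\<close> by (auto simp: mat_eigenvalue_def)
    fix l assume "l \<noteq> 0 \<and> mat_eigenvalue G l"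
    then obtain v where v: "l \<noteq> 0" "v \<noteq> 0" "G *v v = l *\<^sub>R v"
      by (auto simp: mat_eigenvalue_def)
    then have "v = G *v ((1 / l) *\<^sub>R v)" by (simp add: matrix_vector_mult_scaleR)
    then have "v \<in> ?R" unfolding mat_range_def by blast
    then show "mu \<le> l"
      using rayleigh[of v] v inner_B_pos[of v] by (simp add: ip.scaleR_left)
  qed
  then show "0 < lam" "mat_eigenvalue G lam"
      "\<And>x. x \<in> ?R \<Longrightarrow> lam * inner_B B x x \<le> inner_B B (G *v x) x"
    using \<open>mu > 0\<close> rayleigh eigen \<open>u \<noteq> 0\<close> by (auto simp: mat_eigenvalue_def)
qed

end

section \<open>One sketching step\<close>

text \<open>The two properties of \<open>sketch_H\<close> on which everything rests: \<open>H\<close> is symmetric, and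
  \<open>C B\<^sup>-\<^sup>1 C\<^sup>T\<close> is an inner inverse of it. They make \<open>B\<^sup>-\<^sup>1 C\<^sup>T H C\<close> a \<open>B\<close>-orthogonal projection.\<close>

locale sketched_projection = weighted_inner B for B :: "real^'n^'n" +
  fixes C :: "real^'n^'m" and H :: "real^'m^'m"
  assumes H_symmetric: "transpose H = H"
    and H_inner_inverse: "H ** (C ** matrix_inv B ** transpose C) ** H = H"
begin

text \<open>The correction that the step subtracts, as a function of the residual it sees.\<close>

abbreviation lift :: "real^'m \<Rightarrow> real^'n" where
  "lift y \<equiv> (matrix_inv B ** transpose C ** H) *v y"

lemma inner_B_lift: "inner_B B (lift y) x = (H *v y) \<bullet> (C *v x)"
proof -
  have "inner_B B (lift y) x = (transpose C *v (H *v y)) \<bullet> x"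
    by (simp add: inner_B_def B_mult_inv flip: matrix_vector_mul_assoc)
  then show ?thesis by (simp add: inner_matrix_transpose)
qed

lemma H_mult_C_lift: "H *v (C *v lift y) = H *v y"
  by (subst (3) H_inner_inverse[symmetric]) (simp add: matrix_vector_mul_assoc matrix_mul_assoc)

lemma H_swap: "(H *v y) \<bullet> z = y \<bullet> (H *v z)"
  by (simp add: inner_matrix_transpose H_symmetric)

lemma inner_B_lift_lift: "inner_B B (lift y) (lift z) = y \<bullet> (H *v z)"
  by (simp add: inner_B_lift H_swap H_mult_C_lift)

lemma H_nonneg: "0 \<le> y \<bullet> (H *v y)"
  using inner_B_nonneg[of "lift y"] by (simp add: inner_B_lift_lift)

text \<open>A positive semidefinite form vanishes only on the null space of its matrix; here the form is the
  squared norm of \<open>lift y\<close>, and \<open>H y\<close> can be recovered from \<open>lift y\<close>.\<close>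
lemma H_null:
  assumes "y \<bullet> (H *v y) = 0"
  shows "H *v y = 0"
proof -
  have "inner_B B (lift y) (lift y) = 0" using assms by (simp add: inner_B_lift_lift)
  then show ?thesis using H_mult_C_lift[of y] by simp
qed

text \<open>Pythagoras: the projection \<open>lift (C f)\<close> is orthogonal to the remainder \<open>f - lift (C f)\<close>, and so is
  the noise term \<open>lift r\<close>, which lies in the range of \<open>lift\<close>.\<close>
lemma step_norm:
  "inner_B B (f - lift (C *v f - r)) (f - lift (C *v f - r))
    = inner_B B f f - (C *v f) \<bullet> (H *v (C *v f)) + r \<bullet> (H *v r)"
proof -
  define y where "y = C *v f - r"
  have "C *v f = y + r" by (simp add: y_def)
  then have "inner_B B f (lift y) = y \<bullet> (H *v y) + y \<bullet> (H *v r)"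
    using inner_B_lift[of y f] by (simp add: inner_B_commute H_swap algebra_simps)
  moreover have "r \<bullet> (H *v y) = y \<bullet> (H *v r)"
    by (metis H_swap inner_commute)
  ultimately show ?thesis
    unfolding y_def[symmetric] \<open>C *v f = y + r\<close>
    by (simp add: inner_B_square_diff inner_B_lift_lift algebra_simps)
qed

lemma step_orthogonal:
  assumes "H *v (C *v v) = 0"
  shows "inner_B B (f - lift y) v = inner_B B f v"
  by (simp add: ip.diff_left inner_B_lift H_swap assms)

lemma H_le_inner_B: "(C *v f) \<bullet> (H *v (C *v f)) \<le> inner_B B f f"
  using step_norm[of f 0] inner_B_nonneg[of "f - lift (C *v f - 0)"] by simp

end

text \<open>With \<open>K = Z\<^sup>T (C B\<^sup>-\<^sup>1 C\<^sup>T) Z\<close> the inner inverse property is the Penrose equation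
  \<open>K\<^sup>\<dagger> K K\<^sup>\<dagger> = K\<^sup>\<dagger>\<close>, multiplied by \<open>Z\<close> and \<open>Z\<^sup>T\<close>.\<close>
lemma sketch_H_projection:
  assumes "sym_pos_def B"
  shows "sketched_projection B C (sketch_H B C Z)"
proof -
  interpret weighted_inner B by standard fact
  define W where "W = C ** matrix_inv B ** transpose C"
  define K where "K = transpose Z ** W ** Z"
  have H: "sketch_H B C Z = Z ** pinv K ** transpose Z"
    by (simp add: sketch_H_def K_def W_def matrix_mul_assoc)
  have "transpose W = W"
    by (simp add: W_def matrix_transpose_mul transpose_matrix_inv_B matrix_mul_assoc)
  then have "transpose (pinv K) = pinv K"
    by (intro transpose_pinv_symmetric) (simp add: K_def matrix_transpose_mul matrix_mul_assoc)
  then have "transpose (sketch_H B C Z) = sketch_H B C Z"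
    by (simp add: H matrix_transpose_mul matrix_mul_assoc)
  moreover have "sketch_H B C Z ** W ** sketch_H B C Z = Z ** (pinv K ** K ** pinv K) ** transpose Z"
    by (simp add: H K_def matrix_mul_assoc)
  moreover have "pinv K ** K ** pinv K = pinv K"
    using is_pinv_pinv[of K] by (simp add: is_pinv_def)
  ultimately show ?thesis
    by unfold_locales (simp_all add: H W_def)
qed

lemma borel_measurable_sketch_H [measurable]:
  "(sketch_H B C :: real^'q^'m \<Rightarrow> real^'m^'m) \<in> borel_measurable borel"
  unfolding sketch_H_def[abs_def] by measurable


section \<open>Averaging over independent sketches\<close>

text \<open>The quadratic form is a sum of products of an entry of \<open>X\<close> with a product of two components
  of \<open>y\<close>, so independence lets the expectation pass to \<open>X\<close>. As \<open>X\<close> and \<open>y\<close> have different types, their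
  independence is stated through real functions of them.\<close>
lemma (in prob_space) indep_quadratic_form:
  fixes X :: "'a \<Rightarrow> real^'m^'m" and y :: "'a \<Rightarrow> real^'m"
  assumes meas [measurable]: "y \<in> borel_measurable M"
    and indep: "\<And>f g. f \<in> borel_measurable borel \<Longrightarrow> g \<in> borel_measurable borel \<Longrightarrow>
      indep_var borel (\<lambda>\<omega>. f (X \<omega>) :: real) borel (\<lambda>\<omega>. g (y \<omega>) :: real)"
    and X: "integrable M X" and y: "integrable M (\<lambda>\<omega>. (norm (y \<omega>))\<^sup>2)"
  shows "integrable M (\<lambda>\<omega>. y \<omega> \<bullet> (X \<omega> *v y \<omega>))" (is ?int)
    and "(\<integral>\<omega>. y \<omega> \<bullet> (X \<omega> *v y \<omega>) \<partial>M) = (\<integral>\<omega>. y \<omega> \<bullet> (integral\<^sup>L M X *v y \<omega>) \<partial>M)" (is ?eq)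
proof -
  have [measurable]: "(\<lambda>u :: real^'m. u $ i) \<in> borel_measurable borel"
      "(\<lambda>A :: real^'m^'m. A $ i) \<in> borel_measurable borel" for i
    by (intro borel_measurable_continuous_onI linear_continuous_on bounded_linear_vec_nth)+
  have entry: "bounded_linear (\<lambda>A :: real^'m^'m. A $ i $ j)" for i j
    by (intro bounded_linear_compose[OF bounded_linear_vec_nth bounded_linear_vec_nth])
  have expand: "u \<bullet> (A *v u) = (\<Sum>i\<in>UNIV. \<Sum>j\<in>UNIV. A $ i $ j * (u $ i * u $ j))"
    for A :: "real^'m^'m" and u
    by (simp add: inner_vec_def matrix_vector_mult_def sum_distrib_left mult_ac)
  have X_int: "integrable M (\<lambda>\<omega>. X \<omega> $ i $ j)"
    and X_eq: "(\<integral>\<omega>. X \<omega> $ i $ j \<partial>M) = integral\<^sup>L M X $ i $ j" for i j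
    using integrable_bounded_linear[OF entry X] integral_bounded_linear[OF entry X] by auto
  have y_int: "integrable M (\<lambda>\<omega>. y \<omega> $ i * y \<omega> $ j)" for i j
  proof (rule Bochner_Integration.integrable_bound[OF y])
    have "\<bar>y \<omega> $ i * y \<omega> $ j\<bar> \<le> (norm (y \<omega>))\<^sup>2" for \<omega>
      unfolding abs_mult power2_eq_square by (intro mult_mono component_le_norm_cart) auto
    then show "AE \<omega> in M. norm (y \<omega> $ i * y \<omega> $ j) \<le> norm ((norm (y \<omega>))\<^sup>2)" by simp
  qed measurable
  have ind: "indep_var borel (\<lambda>\<omega>. X \<omega> $ i $ j) borel (\<lambda>\<omega>. y \<omega> $ i * y \<omega> $ j)" for i j
    by (rule indep[of "\<lambda>A. A $ i $ j" "\<lambda>u. u $ i * u $ j"]) measurable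
  note prod = indep_var_integrable[OF ind X_int y_int] indep_var_lebesgue_integral[OF ind X_int y_int]
  show ?int unfolding expand by (intro Bochner_Integration.integrable_sum prod)
  have "(\<integral>\<omega>. y \<omega> \<bullet> (X \<omega> *v y \<omega>) \<partial>M)
      = (\<Sum>i\<in>UNIV. \<Sum>j\<in>UNIV. integral\<^sup>L M X $ i $ j * (\<integral>\<omega>. y \<omega> $ i * y \<omega> $ j \<partial>M))"
    unfolding expand
    by (simp add: Bochner_Integration.integral_sum prod X_eq)
  also have "\<dots> = (\<integral>\<omega>. y \<omega> \<bullet> (integral\<^sup>L M X *v y \<omega>) \<partial>M)"
    unfolding expand
    by (simp add: Bochner_Integration.integral_sum y_int)
  finally show ?eq .
qed


lemma sketch_iterate_cong:
  assumes "\<And>i. i \<in> {1..k} \<Longrightarrow> Z i = Z' i"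
  shows "sketch_iterate B C d Z x0 k = sketch_iterate B C d Z' x0 k"
  using assms by (induction k) (auto simp: Let_def)

lemma borel_measurable_sketch_iterate:
  fixes C :: "real^'n^'m"
  assumes "{1..k} \<subseteq> I"
  shows "(\<lambda>Z :: nat \<Rightarrow> real^'q^'m. sketch_iterate B C d Z x0 k) \<in> borel_measurable (\<Pi>\<^sub>M i\<in>I. borel)"
  using assms
proof (induction k)
  case (Suc k)
  have [measurable]: "(\<lambda>Z :: nat \<Rightarrow> real^'q^'m. sketch_iterate B C d Z x0 k) \<in> borel_measurable (\<Pi>\<^sub>M i\<in>I. borel)"
    by (rule Suc.IH[OF subset_trans[OF _ Suc.prems]]) auto
  have [measurable]: "(\<lambda>Z :: nat \<Rightarrow> real^'q^'m. Z (Suc k)) \<in> borel_measurable (\<Pi>\<^sub>M i\<in>I. borel)"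
    using Suc.prems by (intro measurable_component_singleton) auto
  show ?case unfolding sketch_iterate.simps Let_def by measurable
qed simp

section \<open>The error process\<close>

text \<open>The random process of iterates, with errors measured from a reference point \<open>xs\<close>.\<close>
locale sketch_process = prob_space M + weighted_inner B
  for M :: "'w measure" and B :: "real^'n^'n" +
  fixes C :: "real^'n^'m" and d :: "real^'m" and S :: "nat \<Rightarrow> 'w \<Rightarrow> real^'q^'m" and xs :: "real^'n"
  assumes iid: "iid_seq M S"
    and integrable_sketch_H: "\<And>j. j \<ge> 1 \<Longrightarrow> integrable M (\<lambda>\<omega>. sketch_H B C (S j \<omega>))"
begin

definition H :: "nat \<Rightarrow> 'w \<Rightarrow> real^'m^'m" where
  "H j \<omega> = sketch_H B C (S j \<omega>)"

definition EH :: "real^'m^'m" where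
  "EH = expectation (H 1)"

definition G :: "real^'n^'n" where
  "G = matrix_inv B ** transpose C ** EH ** C"

definition residual :: "real^'m" where
  "residual = d - C *v xs"

definition err :: "real^'n \<Rightarrow> nat \<Rightarrow> 'w \<Rightarrow> real^'n" where
  "err x0 j \<omega> = sketch_iterate B C d (\<lambda>i. S i \<omega>) x0 j - xs"

sublocale step: sketched_projection B C "H j \<omega>" for j \<omega>
  unfolding H_def using spd by (rule sketch_H_projection)

lemma integrable_H: "j \<ge> 1 \<Longrightarrow> integrable M (H j)"
  using integrable_sketch_H unfolding H_def[abs_def] by simp

lemma indep_S: "indep_vars (\<lambda>_. borel) S {1..}"
  and distr_S: "i \<ge> 1 \<Longrightarrow> j \<ge> 1 \<Longrightarrow> distr M borel (S i) = distr M borel (S j)"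
  using iid unfolding iid_seq_def by blast+

lemma measurable_S: "j \<ge> 1 \<Longrightarrow> S j \<in> borel_measurable M"
  using indep_S by (simp add: indep_vars_def)

lemma expectation_H:
  assumes "j \<ge> 1"
  shows "expectation (H j) = EH"
proof -
  have *: "expectation (H i) = integral\<^sup>L (distr M borel (S i)) (sketch_H B C)" if "i \<ge> 1" for i
    unfolding H_def[abs_def] using measurable_S[OF that] by (intro integral_distr[symmetric]) auto
  have "distr M borel (S j) = distr M borel (S 1)"
    using assms by (intro distr_S) auto
  then show ?thesis using *[OF assms] *[of 1] by (simp add: EH_def)
qed

lemma quadratic_form_H:
  assumes "j \<ge> 1"
  shows "integrable M (\<lambda>\<omega>. y \<bullet> (H j \<omega> *v z))"
    and "expectation (\<lambda>\<omega>. y \<bullet> (H j \<omega> *v z)) = y \<bullet> (EH *v z)"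
proof -
  have "bounded_linear (\<lambda>A :: real^'m^'m. y \<bullet> (A *v z))"
    by (intro bounded_linear_inner_right_comp
        bounded_bilinear.bounded_linear_left[OF bounded_bilinear_matrix_vector_mult])
  from integrable_bounded_linear[OF this integrable_H[OF assms]]
    integral_bounded_linear[OF this integrable_H[OF assms]]
  show "integrable M (\<lambda>\<omega>. y \<bullet> (H j \<omega> *v z))"
    and "expectation (\<lambda>\<omega>. y \<bullet> (H j \<omega> *v z)) = y \<bullet> (EH *v z)"
    by (simp_all add: expectation_H[OF assms])
qed

lemma EH_nonneg: "0 \<le> y \<bullet> (EH *v y)"
  unfolding quadratic_form_H(2)[OF order_refl, symmetric] by (simp add: step.H_nonneg)

lemma EH_swap: "(EH *v y) \<bullet> z = y \<bullet> (EH *v z)"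
proof -
  have "z \<bullet> (H 1 \<omega> *v y) = y \<bullet> (H 1 \<omega> *v z)" for \<omega>
    by (subst step.H_swap[symmetric]) (rule inner_commute)
  then show ?thesis
    using quadratic_form_H(2)[of 1 z y] quadratic_form_H(2)[of 1 y z] by (simp add: inner_commute)
qed

lemma inner_B_G: "inner_B B (G *v x) y = (C *v x) \<bullet> (EH *v (C *v y))"
proof -
  have "inner_B B (G *v x) y = (transpose C *v (EH *v (C *v x))) \<bullet> y"
    by (simp add: G_def inner_B_def B_mult_inv flip: matrix_vector_mul_assoc)
  also have "\<dots> = (EH *v (C *v x)) \<bullet> (C *v y)"
    by (subst inner_matrix_transpose) simp
  finally show ?thesis by (simp only: EH_swap)
qed

sublocale self_adjoint_psd B G
proof
  show "inner_B B (G *v x) y = inner_B B x (G *v y)" for x y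
    using inner_B_commute[of x "G *v y"] EH_swap[of "C *v x" "C *v y"]
    by (simp add: inner_B_G inner_commute)
qed (simp add: inner_B_G EH_nonneg)

lemma G_le_inner_B: "inner_B B (G *v x) x \<le> inner_B B x x"
proof -
  have "expectation (\<lambda>\<omega>. (C *v x) \<bullet> (H 1 \<omega> *v (C *v x))) \<le> expectation (\<lambda>_. inner_B B x x)"
    by (intro integral_mono quadratic_form_H step.H_le_inner_B) auto
  then show ?thesis by (simp add: inner_B_G quadratic_form_H prob_space)
qed

lemma smallest_nonzero_eigenvalue_le_1:
  assumes "G \<noteq> 0"
  shows "smallest_nonzero_eigenvalue G \<le> 1"
proof -
  obtain v where v: "v \<noteq> 0" "G *v v = smallest_nonzero_eigenvalue G *\<^sub>R v"
    using smallest_nonzero_eigenvalue_rayleigh(2)[OF assms] by (auto simp: mat_eigenvalue_def)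
  then show ?thesis
    using G_le_inner_B[of v] inner_B_pos[OF v(1)] by (simp add: ip.scaleR_left)
qed

text \<open>A nonnegative variable with expectation \<open>0\<close> vanishes almost surely. To find one null set that
  serves all \<open>v\<close>, it suffices to treat the finitely many vectors of a basis.\<close>
lemma AE_H_vanishes_on_null:
  "AE \<omega> in M. \<forall>j\<ge>1. \<forall>v\<in>mat_null G. H j \<omega> *v (C *v v) = 0"
proof -
  have single: "AE \<omega> in M. H j \<omega> *v (C *v v) = 0" if "j \<ge> 1" "v \<in> mat_null G" for j v
  proof -
    have "expectation (\<lambda>\<omega>. (C *v v) \<bullet> (H j \<omega> *v (C *v v))) = inner_B B (G *v v) v"
      by (simp add: quadratic_form_H(2)[OF that(1)] inner_B_G)
    also have "\<dots> = 0" using that by (simp add: mat_null_def ip.zero_left)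
    finally have "AE \<omega> in M. (C *v v) \<bullet> (H j \<omega> *v (C *v v)) = 0"
      by (subst (asm) integral_nonneg_eq_0_iff_AE)
         (auto simp: quadratic_form_H(1)[OF that(1)] step.H_nonneg)
    then show ?thesis by eventually_elim (rule step.H_null)
  qed
  obtain D where D: "D \<subseteq> mat_null G" "independent D" "span D = mat_null G"
    using basis_subspace_exists[OF subspace_mat_null] by metis
  have "finite D" using D(2) by (rule independent_imp_finite)
  have "AE \<omega> in M. \<forall>v\<in>D. H j \<omega> *v (C *v v) = 0" if "j \<ge> 1" for j
    using \<open>finite D\<close> single[OF that] D(1) by (intro AE_finite_allI) auto
  then have "AE \<omega> in M. \<forall>j. j \<ge> 1 \<longrightarrow> (\<forall>v\<in>D. H j \<omega> *v (C *v v) = 0)"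
    by (subst AE_all_countable) auto
  then show ?thesis
  proof eventually_elim
    fix \<omega> assume *: "\<forall>j. j \<ge> 1 \<longrightarrow> (\<forall>v\<in>D. H j \<omega> *v (C *v v) = 0)"
    have "H j \<omega> *v (C *v v) = 0" if "j \<ge> 1" "v \<in> span D" for j v
    proof -
      have "linear (\<lambda>v. H j \<omega> *v (C *v v))" by (simp add: matrix_vector_mul_assoc)
      then show ?thesis
        using linear_eq_0_on_span[of "\<lambda>v. H j \<omega> *v (C *v v)" D v] * that by auto
    qed
    then show "\<forall>j\<ge>1. \<forall>v\<in>mat_null G. H j \<omega> *v (C *v v) = 0" using D(3) by blast
  qed
qed

lemma err_0 [simp]: "err x0 0 \<omega> = x0 - xs"
  by (simp add: err_def)

lemma err_Suc:
  "err x0 (Suc j) \<omega> = err x0 j \<omega> - step.lift (Suc j) \<omega> (C *v err x0 j \<omega> - residual)"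
  by (simp add: err_def H_def residual_def Let_def algebra_simps)

text \<open>The steps do not see a vector of the null space, so changing the initial point by it shifts all
  later errors by the same vector.\<close>
lemma AE_err_shift_null:
  assumes "n \<in> mat_null G"
  shows "AE \<omega> in M. err (x0 + n) j \<omega> = err x0 j \<omega> + n"
  using AE_H_vanishes_on_null
proof eventually_elim
  case (elim \<omega>)
  show ?case
  proof (induction j)
    case (Suc j)
    have "step.lift (Suc j) \<omega> (C *v n) = 0"
      using elim assms by (simp flip: matrix_vector_mul_assoc)
    then show ?case
      unfolding err_Suc Suc by (simp add: algebra_simps)
  qed simp
qed

text \<open>Almost surely the corrections are orthogonal to the null space, whose orthogonal complement is the
  range.\<close>
lemma AE_err_in_range:
  assumes "x0 - xs \<in> mat_range G"
  shows "AE \<omega> in M. err x0 j \<omega> \<in> mat_range G"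
  using AE_H_vanishes_on_null
proof eventually_elim
  case (elim \<omega>)
  have "inner_B B (err x0 j \<omega>) v = 0" if "v \<in> mat_null G" for v
  proof (induction j)
    case 0
    show ?case using range_orthogonal_null[OF assms that] by simp
  next
    case (Suc j)
    have "H (Suc j) \<omega> *v (C *v v) = 0" using elim that by auto
    then show ?case unfolding err_Suc by (simp add: step.step_orthogonal Suc)
  qed
  then show ?case by (rule orthogonal_null_imp_range)
qed

lemma measurable_err: "err x0 j \<in> borel_measurable M"
proof -
  have "(\<lambda>\<omega>. \<lambda>i\<in>{1..}. S i \<omega>) \<in> measurable M (\<Pi>\<^sub>M i\<in>{1..}. borel)"
    by (intro measurable_restrict measurable_S) auto
  moreover have "(\<lambda>Z :: nat \<Rightarrow> real^'q^'m. sketch_iterate B C d Z x0 j - xs) \<in> borel_measurable (\<Pi>\<^sub>M i\<in>{1..}. borel)"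
    by (intro borel_measurable_diff borel_measurable_sketch_iterate) auto
  ultimately have "(\<lambda>\<omega>. sketch_iterate B C d (\<lambda>i\<in>{1..}. S i \<omega>) x0 j - xs) \<in> borel_measurable M"
    by (rule measurable_compose)
  also have "(\<lambda>\<omega>. sketch_iterate B C d (\<lambda>i\<in>{1..}. S i \<omega>) x0 j - xs) = err x0 j"
    unfolding err_def by (intro ext arg_cong2[where f="(-)"] sketch_iterate_cong) auto
  finally show ?thesis .
qed

text \<open>The \<open>j\<close>-th iterate is a Borel function of the first \<open>j\<close> sketch matrices, a block disjoint from
  the next one.\<close>
lemma indep_H_err:
  fixes f :: "real^'m^'m \<Rightarrow> real" and g :: "real^'m \<Rightarrow> real"
  assumes [measurable]: "f \<in> borel_measurable borel" "g \<in> borel_measurable borel"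
  shows "indep_var borel (\<lambda>\<omega>. f (H (Suc j) \<omega>)) borel (\<lambda>\<omega>. g (C *v err x0 j \<omega>))"
proof -
  let ?R = "\<lambda>A \<omega>. \<lambda>i\<in>A. S i \<omega>"
  define F where "F Z = f (sketch_H B C (Z (Suc j)))" for Z :: "nat \<Rightarrow> real^'q^'m"
  define E where "E Z = g (C *v (sketch_iterate B C d Z x0 j - xs))" for Z :: "nat \<Rightarrow> real^'q^'m"
  have [measurable]: "(\<lambda>Z :: nat \<Rightarrow> real^'q^'m. sketch_iterate B C d Z x0 j) \<in> borel_measurable (\<Pi>\<^sub>M i\<in>{1..j}. borel)"
    by (rule borel_measurable_sketch_iterate) simp
  have [measurable]: "(\<lambda>Z :: nat \<Rightarrow> real^'q^'m. Z (Suc j)) \<in> borel_measurable (\<Pi>\<^sub>M i\<in>{Suc j}. borel)"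
    by (intro measurable_component_singleton) auto
  have "F \<in> borel_measurable (\<Pi>\<^sub>M i\<in>{Suc j}. borel)" "E \<in> borel_measurable (\<Pi>\<^sub>M i\<in>{1..j}. borel)"
    unfolding F_def E_def by measurable
  moreover have "indep_var (\<Pi>\<^sub>M i\<in>{Suc j}. borel) (?R {Suc j}) (\<Pi>\<^sub>M i\<in>{1..j}. borel) (?R {1..j})"
    by (rule indep_var_restrict[OF indep_S]) auto
  ultimately have "indep_var borel (F \<circ> ?R {Suc j}) borel (E \<circ> ?R {1..j})"
    by (intro indep_var_compose)
  moreover have "F \<circ> ?R {Suc j} = (\<lambda>\<omega>. f (H (Suc j) \<omega>))"
    by (simp add: fun_eq_iff F_def H_def)
  moreover have "E \<circ> ?R {1..j} = (\<lambda>\<omega>. g (C *v err x0 j \<omega>))"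
  proof
    fix \<omega>
    have "sketch_iterate B C d (?R {1..j} \<omega>) x0 j = sketch_iterate B C d (\<lambda>i. S i \<omega>) x0 j"
      by (rule sketch_iterate_cong) simp
    then show "(E \<circ> ?R {1..j}) \<omega> = g (C *v err x0 j \<omega>)" by (simp add: E_def err_def)
  qed
  ultimately show ?thesis by simp
qed

text \<open>The energy balance of one step, averaged. The loss is a quadratic form of the new sketch in the
  independent old error, so only \<open>G\<close> survives of that sketch.\<close>

lemma expected_step:
  assumes int: "integrable M (\<lambda>\<omega>. inner_B B (err x0 j \<omega>) (err x0 j \<omega>))"
  shows "integrable M (\<lambda>\<omega>. inner_B B (err x0 (Suc j) \<omega>) (err x0 (Suc j) \<omega>))"
    and "integrable M (\<lambda>\<omega>. inner_B B (G *v err x0 j \<omega>) (err x0 j \<omega>))"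
    and "expectation (\<lambda>\<omega>. inner_B B (err x0 (Suc j) \<omega>) (err x0 (Suc j) \<omega>))
      = expectation (\<lambda>\<omega>. inner_B B (err x0 j \<omega>) (err x0 j \<omega>))
        - expectation (\<lambda>\<omega>. inner_B B (G *v err x0 j \<omega>) (err x0 j \<omega>))
        + residual \<bullet> (EH *v residual)"
proof -
  let ?e = "err x0 j"
  let ?Q = "\<lambda>\<omega>. (C *v ?e \<omega>) \<bullet> (H (Suc j) \<omega> *v (C *v ?e \<omega>))"
  note [measurable] = measurable_err
  obtain c where c: "c > 0" "\<And>x. c * (norm x)\<^sup>2 \<le> inner_B B x x"
    using inner_B_coercive by blast
  obtain K where K: "K > 0" "\<And>x. norm (C *v x) \<le> norm x * K"
    using bounded_linear.pos_bounded[OF matrix_vector_mul_bounded_linear] by blast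
  have "integrable M (\<lambda>\<omega>. (norm (C *v ?e \<omega>))\<^sup>2)"
  proof (rule Bochner_Integration.integrable_bound)
    show "integrable M (\<lambda>\<omega>. K\<^sup>2 / c * inner_B B (?e \<omega>) (?e \<omega>))" using int by simp
    have "(norm (C *v x))\<^sup>2 \<le> K\<^sup>2 / c * inner_B B x x" for x
    proof -
      have "(norm (C *v x))\<^sup>2 \<le> (norm x * K)\<^sup>2" using K by (intro power_mono) auto
      also have "\<dots> = K\<^sup>2 / c * (c * (norm x)\<^sup>2)" using c(1) by (simp add: power_mult_distrib)
      also have "\<dots> \<le> K\<^sup>2 / c * inner_B B x x" using c by (intro mult_left_mono) auto
      finally show ?thesis .
    qed
    then show "AE \<omega> in M. norm ((norm (C *v ?e \<omega>))\<^sup>2) \<le> norm (K\<^sup>2 / c * inner_B B (?e \<omega>) (?e \<omega>))"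
      using c(1) by (simp add: abs_mult inner_B_nonneg)
  qed measurable
  note Q = indep_quadratic_form[OF _ indep_H_err integrable_H this, simplified expectation_H]
  have Q_int: "integrable M ?Q" using Q(1) by simp
  have Q_eq: "expectation ?Q = expectation (\<lambda>\<omega>. inner_B B (G *v ?e \<omega>) (?e \<omega>))"
    using Q(2) by (simp add: expectation_H inner_B_G)
  note R = quadratic_form_H[of "Suc j" residual residual, simplified]
  show "integrable M (\<lambda>\<omega>. inner_B B (err x0 (Suc j) \<omega>) (err x0 (Suc j) \<omega>))"
    unfolding err_Suc step.step_norm using int Q_int R(1) by simp
  show "expectation (\<lambda>\<omega>. inner_B B (err x0 (Suc j) \<omega>) (err x0 (Suc j) \<omega>))
      = expectation (\<lambda>\<omega>. inner_B B (?e \<omega>) (?e \<omega>))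
        - expectation (\<lambda>\<omega>. inner_B B (G *v ?e \<omega>) (?e \<omega>)) + residual \<bullet> (EH *v residual)"
    unfolding err_Suc step.step_norm using int Q_int R Q_eq by simp
  show "integrable M (\<lambda>\<omega>. inner_B B (G *v ?e \<omega>) (?e \<omega>))"
  proof (rule Bochner_Integration.integrable_bound[OF int])
    show "AE \<omega> in M. norm (inner_B B (G *v ?e \<omega>) (?e \<omega>)) \<le> norm (inner_B B (?e \<omega>) (?e \<omega>))"
      by (simp add: psd inner_B_nonneg G_le_inner_B)
    show "(\<lambda>\<omega>. inner_B B (G *v ?e \<omega>) (?e \<omega>)) \<in> borel_measurable M"
      unfolding inner_B_def by measurable
  qed
qed

lemma integrable_err: "integrable M (\<lambda>\<omega>. inner_B B (err x0 j \<omega>) (err x0 j \<omega>))"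
  by (induction j) (auto intro: expected_step)

section \<open>Bounds on the expected error\<close>

text \<open>The bound without a null component. The additive constant \<open>c / lam\<close> is the fixed point of
  \<open>a \<mapsto> (1 - lam) a + c\<close>, so it survives the induction step,
  which is monotone in the previous bound because \<open>1 - lam\<close> is nonnegative.\<close>
lemma expected_err_range_bound:
  assumes "G \<noteq> 0" and range: "x0 - xs \<in> mat_range G"
  defines "lam \<equiv> smallest_nonzero_eigenvalue G"
  shows "expectation (\<lambda>\<omega>. inner_B B (err x0 j \<omega>) (err x0 j \<omega>))
    \<le> (1 - lam) ^ j * inner_B B (x0 - xs) (x0 - xs) + residual \<bullet> (EH *v residual) / lam"
proof (induction j)
  case 0
  have "lam > 0" unfolding lam_def by (rule smallest_nonzero_eigenvalue_rayleigh) fact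
  then show ?case by (simp add: prob_space EH_nonneg)
next
  case (Suc j)
  let ?E = "\<lambda>j. expectation (\<lambda>\<omega>. inner_B B (err x0 j \<omega>) (err x0 j \<omega>))"
  let ?c = "residual \<bullet> (EH *v residual)"
  have lam: "lam > 0" "lam \<le> 1"
    unfolding lam_def
    using smallest_nonzero_eigenvalue_rayleigh(1) smallest_nonzero_eigenvalue_le_1 assms(1) by auto
  note step = expected_step[OF integrable_err, of x0 j]
  have "lam * ?E j = expectation (\<lambda>\<omega>. lam * inner_B B (err x0 j \<omega>) (err x0 j \<omega>))"
    by simp
  also have "\<dots> \<le> expectation (\<lambda>\<omega>. inner_B B (G *v err x0 j \<omega>) (err x0 j \<omega>))"
    using AE_err_in_range[OF range, of j]
    by (intro integral_mono_AE integrable_mult_right integrable_err step(2))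
       (auto elim!: eventually_mono simp: lam_def smallest_nonzero_eigenvalue_rayleigh(3) assms(1))
  finally have "?E (Suc j) \<le> (1 - lam) * ?E j + ?c"
    using step(3) by (simp add: algebra_simps)
  also have "\<dots> \<le> (1 - lam) * ((1 - lam) ^ j * inner_B B (x0 - xs) (x0 - xs) + ?c / lam) + ?c"
    using lam Suc by (intro add_right_mono mult_left_mono) auto
  also have "\<dots> = (1 - lam) ^ Suc j * inner_B B (x0 - xs) (x0 - xs) + ?c / lam"
    using lam(1) by (simp add: field_simps)
  finally show ?case .
qed

lemma expected_err_bound:
  assumes "G \<noteq> 0"
  defines "lam \<equiv> smallest_nonzero_eigenvalue G"
  shows "expectation (\<lambda>\<omega>. (norm_B B (err x0 k \<omega>))\<^sup>2)
    \<le> (1 - lam) ^ k * (norm_B B (component_in (mat_range G) (mat_null G) (x0 - xs)))\<^sup>2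
      + (norm_B B (component_in (mat_null G) (mat_range G) (x0 - xs)))\<^sup>2
      + residual \<bullet> (EH *v residual) / lam"
proof -
  obtain u w where u: "u \<in> mat_range G" and w: "w \<in> mat_null G" and uw: "x0 - xs = u + w"
    by (rule range_null_decomposition)
  \<comment> \<open>The initial point whose error is the range component alone; the errors from \<open>x0\<close> and \<open>y\<close> differ
    almost surely by the constant, orthogonal vector \<open>w\<close>.\<close>
  define y where "y = xs + u"
  have x0: "x0 = y + w" using uw by (simp add: y_def algebra_simps)
  have y: "y - xs = u" by (simp add: y_def)
  have "AE \<omega> in M. inner_B B (err x0 k \<omega>) (err x0 k \<omega>)
      = inner_B B (err y k \<omega>) (err y k \<omega>) + inner_B B w w"
    using AE_err_shift_null[OF w, of y k] AE_err_in_range[of y k, unfolded y, OF u]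
    unfolding x0
    by eventually_elim (simp add: inner_B_square_add range_orthogonal_null[OF _ w])
  then have "expectation (\<lambda>\<omega>. inner_B B (err x0 k \<omega>) (err x0 k \<omega>))
      = expectation (\<lambda>\<omega>. inner_B B (err y k \<omega>) (err y k \<omega>) + inner_B B w w)"
    using integrable_err[of x0 k] integrable_err[of y k] by (intro integral_cong_AE) auto
  also have "\<dots> = expectation (\<lambda>\<omega>. inner_B B (err y k \<omega>) (err y k \<omega>)) + inner_B B w w"
    using integrable_err[of y k] by (simp add: prob_space)
  also have "\<dots> \<le> ((1 - lam) ^ k * inner_B B u u + residual \<bullet> (EH *v residual) / lam) + inner_B B w w"
    using expected_err_range_bound[OF assms(1), of y k] u by (simp add: y lam_def)
  finally show ?thesis
    by (simp add: norm_B_square uw component_in_range_null[OF u w])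
qed

end

theorem theorem5p2:
  fixes M :: "'w measure"
    and A At :: "real^'n^'m" and b bt :: "real^'m"
    and B :: "real^'n^'n"
    and S :: "nat \<Rightarrow> 'w \<Rightarrow> real^'q^'m"
    and x0 x_LS :: "real^'n" and r :: "real^'m"
    and G :: "real^'n^'n" and lam :: real and k :: nat
  assumes "prob_space M"
    and "sym_pos_def B"
    and "iid_seq M S"
    and "\<And>j. j \<ge> 1 \<Longrightarrow> integrable M (\<lambda>\<omega>. sketch_H B At (S j \<omega>))"
    and "k \<ge> 1"
    and "G = (\<integral>\<omega>. sketch_P B At (S k \<omega>) \<partial>M)"
    and "G \<noteq> 0"
    and "lam = smallest_nonzero_eigenvalue G"
    and "x_LS = pinv A *v b"
    and "r = bt - At *v x_LS"
  shows "integrable M (\<lambda>\<omega>. (norm_B B (sketch_iterate B At bt (\<lambda>j. S j \<omega>) x0 k - x_LS))\<^sup>2) \<and>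
    (\<integral>\<omega>. (norm_B B (sketch_iterate B At bt (\<lambda>j. S j \<omega>) x0 k - x_LS))\<^sup>2 \<partial>M)
      \<le> (1 - lam) ^ k * (norm_B B (component_in (mat_range G) (mat_null G) (x0 - x_LS)))\<^sup>2
        + (norm_B B (component_in (mat_null G) (mat_range G) (x0 - x_LS)))\<^sup>2
        + (r \<bullet> ((\<integral>\<omega>. sketch_H B At (S k \<omega>) \<partial>M) *v r)) / lam"
proof -
  interpret prob_space M by fact
  interpret p: sketch_process M B At bt S x_LS
    by unfold_locales (fact assms)+
  have EH: "expectation (\<lambda>\<omega>. sketch_H B At (S k \<omega>)) = p.EH"
    using p.expectation_H[OF \<open>k \<ge> 1\<close>] by (simp add: p.H_def[abs_def])
  have "bounded_linear (\<lambda>X. matrix_inv B ** transpose At ** X ** At)"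
    by (intro bounded_linear_compose[OF
          bounded_bilinear.bounded_linear_left[OF bounded_bilinear_matrix_mult]
          bounded_bilinear.bounded_linear_right[OF bounded_bilinear_matrix_mult]])
  from integral_bounded_linear[OF this assms(4)[OF \<open>k \<ge> 1\<close>]]
  have G: "G = p.G"
    unfolding assms(6) sketch_P_def EH p.G_def .
  show ?thesis
    using p.integrable_err[of x0 k] p.expected_err_bound[of x0 k] \<open>G \<noteq> 0\<close>
    unfolding EH assms(8,10) G p.norm_B_square p.err_def p.residual_def by blast
qed

end
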